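(* Let $f:[0,1]\times\mathbb{R}^2\to\mathbb{R}$ be continuous and consider the periodic boundary value problem $$-x''=f(t,x,x')\quad (t\in[0,1]),\qquad x(0)=x(1),\quad x'(0)=x'(1). \qquad (P)$$ Suppose that: (i) $(P)$ has a lower solution $\alpha$ and an upper solution $\beta$ with $\alpha(t)\le\beta(t)$ for $t\in[0,1]$, $\alpha'(0)-\alpha'(1)\ge0$ and $\beta'(1)-\beta'(0)\ge0$; and there are constants $\mu>0$ and $\ell>0$ such that $$|f(t,x_1,y_1)-f(t,x_2,y_2)|\le\ell|x_1-x_2|+\ell|y_1-y_2|$$ whenever $(t,x_i,y_i)\in G_{\alpha,\mu}$ for $i=1,2$, or $(t,x_i,y_i)\in G_{\beta,\mu}$ for $i=1,2$. (ii) There are constants $L>0$, $K>0$, a constant $c<1$, and a function $c(t)\ge0$ on $[0,1]$ with $c(t)(\beta(t)-\alpha(t))\le c$ for all $t\in[0,1]$, such that $$f(t,x,\alpha'(t)-z)-f(t,x,\alpha'(t))\ge -c(t)z^2-Lz-K,$$ $$f(t,x,\beta'(t))-f(t,x,\beta'(t)+z)\ge -c(t)z^2-Lz-K$$ whenever $t\in[0,1]$, $\alpha(t)\le x\le\beta(t)$ and $z\ge0$. Then problem $(P)$ has a solution $x(t)$ satisfying $\alpha(t)\le x(t)\le\beta(t)$ for all $t\in[0,1]$.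
   Context: A function $\alpha\in C^2[0,1]$ is a lower solution of $(P)$ if $-\alpha''(t)\le f(t,\alpha(t),\alpha'(t))$ for $t\in[0,1]$ and $\alpha(0)=\alpha(1)$. A function $\beta\in C^2[0,1]$ is an upper solution of $(P)$ if $-\beta''(t)\ge f(t,\beta(t),\beta'(t))$ for $t\in[0,1]$ and $\beta(0)=\beta(1)$. For $\gamma\in C^1[0,1]$ and $\mu>0$, $$G_{\gamma,\mu}=\{(t,x,y)\in\mathbb{R}^3:\ t\in[0,1],\ \gamma(t)-\mu\le x\le\gamma(t)+\mu,\ \gamma'(t)-\mu\le y\le\gamma'(t)+\mu\}.$$ *)

theory Defs
  imports "HOL-Analysis.Analysis"
begin

text \<open>Derivatives on the compact interval are taken relative to it, hence one-sided at the
  end points.\<close>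

definition deriv01 :: "(real \<Rightarrow> real) \<Rightarrow> real \<Rightarrow> real" where
  "deriv01 u t = vector_derivative u (at t within {0..1})"

definition C1_01 :: "(real \<Rightarrow> real) \<Rightarrow> bool" where
  "C1_01 u \<longleftrightarrow> u differentiable_on {0..1} \<and> continuous_on {0..1} (deriv01 u)"

definition C2_01 :: "(real \<Rightarrow> real) \<Rightarrow> bool" where
  "C2_01 u \<longleftrightarrow> C1_01 u \<and> C1_01 (deriv01 u)"

text \<open>The problem \<open>- x'' = f(t, x, x')\<close> on \<open>[0, 1]\<close> with periodic boundary conditions.
  Lower and upper solutions are only required to have equal end point values; the conditions on
  their end point derivatives are separate hypotheses.\<close>

definition lower_solution :: "(real \<times> real \<times> real \<Rightarrow> real) \<Rightarrow> (real \<Rightarrow> real) \<Rightarrow> bool" where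
  "lower_solution f \<alpha> \<longleftrightarrow> C2_01 \<alpha> \<and>
     (\<forall>t\<in>{0..1}. - deriv01 (deriv01 \<alpha>) t \<le> f (t, \<alpha> t, deriv01 \<alpha> t)) \<and> \<alpha> 0 = \<alpha> 1"

definition upper_solution :: "(real \<times> real \<times> real \<Rightarrow> real) \<Rightarrow> (real \<Rightarrow> real) \<Rightarrow> bool" where
  "upper_solution f \<beta> \<longleftrightarrow> C2_01 \<beta> \<and>
     (\<forall>t\<in>{0..1}. - deriv01 (deriv01 \<beta>) t \<ge> f (t, \<beta> t, deriv01 \<beta> t)) \<and> \<beta> 0 = \<beta> 1"

definition periodic_solution :: "(real \<times> real \<times> real \<Rightarrow> real) \<Rightarrow> (real \<Rightarrow> real) \<Rightarrow> bool" where
  "periodic_solution f x \<longleftrightarrow> C2_01 x \<and>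
     (\<forall>t\<in>{0..1}. - deriv01 (deriv01 x) t = f (t, x t, deriv01 x t)) \<and>
     x 0 = x 1 \<and> deriv01 x 0 = deriv01 x 1"

definition G :: "(real \<Rightarrow> real) \<Rightarrow> real \<Rightarrow> (real \<times> real \<times> real) set" where
  "G \<gamma> \<mu> = {(t, x, y). t \<in> {0..1} \<and> \<gamma> t - \<mu> \<le> x \<and> x \<le> \<gamma> t + \<mu> \<and>
     deriv01 \<gamma> t - \<mu> \<le> y \<and> y \<le> deriv01 \<gamma> t + \<mu>}"

end

theory Submission
  imports Defs "HOL-Complex_Analysis.Great_Picard"
begin

text \<open>Clamping \<open>x\<close> between \<open>\<alpha>\<close> and \<open>\<beta>\<close> and \<open>x'\<close> between \<open>- N\<close> and \<open>N\<close> turns \<open>(P)\<close> into \<open>x'' = x + g\<close> with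
  \<open>g\<close> bounded and continuous. Periodic solutions of the Euler scheme for this equation exist by Brouwer's
  theorem in the plane, and they converge along a subsequence by Arzela--Ascoli. The minimum principle,
  applied to \<open>x - \<alpha>\<close> and \<open>\<beta> - x\<close>, gives \<open>\<alpha> \<le> x \<le> \<beta>\<close>.

  It remains to bound \<open>x'\<close> independently of \<open>N\<close>. Let \<open>u = x - \<alpha> \<ge> 0\<close> and suppose that \<open>- u'\<close> is very large
  at some \<open>t0\<close>. As long as \<open>u' \<le> -1\<close>, the growth condition makes \<open>ln (- u') - c ln u + L t\<close> nondecreasing,
  so \<open>- u'\<close> can drop to \<open>1\<close> only after \<open>u\<close> has become a tiny fraction of \<open>u t0\<close>. Near \<open>\<alpha>\<close> the Lipschitz
  condition then keeps the growth of \<open>u\<close> at most exponential at a fixed rate, so \<open>u\<close> cannot return to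
  \<open>u t0\<close> within one period. The same argument for \<open>\<beta> - x\<close> bounds \<open>x'\<close> from above.\<close>

section \<open>Bounded periodic problems\<close>

definition hat :: "nat \<Rightarrow> nat \<Rightarrow> real \<Rightarrow> real" where
  "hat n j t = max 0 (min (t - real j / real n) (1 / real n))"

text \<open>The first \<open>m\<close> grid cells tile the interval from 0 to \<open>m / n\<close>,
  and \<open>hat n j t\<close> is the length of the part of cell \<open>j\<close> to the left of
  \<open>t\<close>.\<close>

lemma sum_hat:
  assumes "0 \<le> t" "n > 0"
  shows "(\<Sum>j<m. hat n j t) = min t (real m / real n)"
proof (induction m)
  case 0 then show ?case using assms by simp
next
  case (Suc m)
  have "real (Suc m) / real n = real m / real n + 1 / real n"
    by (simp add: add_divide_distrib)
  moreover have "1 / real n > 0" using assms by simp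
  moreover have "(\<Sum>j<Suc m. hat n j t) = min t (real m / real n) + hat n m t" using Suc by simp
  ultimately show ?case unfolding hat_def by linarith
qed

lemma hat_mono: "s \<le> t \<Longrightarrow> hat n j s \<le> hat n j t"
  by (auto simp: hat_def)

lemma hat_eq:
  assumes "s \<le> t" "n > 0" "t \<le> real j / real n \<or> real j / real n + 1 / real n \<le> s"
  shows "hat n j s = hat n j t"
proof -
  have "1 / real n > 0" using assms by simp
  then show ?thesis using assms(1,3) unfolding hat_def by linarith
qed

lemma hat_node:
  assumes "n > 0"
  shows "hat n j (real k / real n) = (if j < k then 1 / real n else 0)"
proof (cases "j < k")
  case True
  then have "real k \<ge> real j + 1" by linarith
  then have "real k / real n \<ge> (real j + 1) / real n" using assms by (intro divide_right_mono) auto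
  then show ?thesis using True by (auto simp: hat_def add_divide_distrib)
next
  case False
  then have "real k / real n \<le> real j / real n" using assms by (intro divide_right_mono) auto
  moreover have "1 / real n > 0" using assms by simp
  ultimately show ?thesis using False by (auto simp: hat_def)
qed

text \<open>The polygonal interpolant with slopes \<open>d j\<close> is a combination of the primitives \<open>hat n j\<close> of the
  indicator functions of the grid intervals, so its increments are averages of the slopes.\<close>

definition polygon :: "nat \<Rightarrow> 'a::real_normed_vector \<Rightarrow> (nat \<Rightarrow> 'a) \<Rightarrow> real \<Rightarrow> 'a" where
  "polygon n z d t = z + (\<Sum>j<n. hat n j t *\<^sub>R d j)"

text \<open>The increments of the \<open>hat n j\<close> from \<open>s\<close> to \<open>t\<close>
  are nonnegative weights of sum \<open>t - s\<close>, zero for cells disjoint from the open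
  interval between \<open>s\<close> and \<open>t\<close>; so only slopes of cells met by it matter.
  With \<open>v = 0\<close> this gives a Lipschitz bound, with \<open>v\<close> a candidate
  derivative it gives the error of linear approximation.\<close>

lemma polygon_diff:
  assumes "0 \<le> s" "s \<le> t" "t \<le> 1" "n > 0"
    and d: "\<And>j. j < n \<Longrightarrow> real j / real n < t \<Longrightarrow> s < real j / real n + 1 / real n \<Longrightarrow> norm (d j - v) \<le> e"
  shows "norm (polygon n z d t - polygon n z d s - (t - s) *\<^sub>R v) \<le> e * (t - s)"
proof -
  have S: "(\<Sum>j<n. hat n j t - hat n j s) = t - s"
    using assms sum_hat[of t n n] sum_hat[of s n n] by (simp add: sum_subtractf)
  have "polygon n z d t - polygon n z d s - (t - s) *\<^sub>R v
      = (\<Sum>j<n. (hat n j t - hat n j s) *\<^sub>R (d j - v))"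
    unfolding polygon_def S[symmetric]
    by (simp add: sum_subtractf algebra_simps scaleR_sum_left sum.distrib)
  also have "norm \<dots> \<le> (\<Sum>j<n. (hat n j t - hat n j s) * e)"
  proof (rule sum_norm_le)
    fix j assume "j \<in> {..<n}"
    show "norm ((hat n j t - hat n j s) *\<^sub>R (d j - v)) \<le> (hat n j t - hat n j s) * e"
    proof (cases "real j / real n < t \<and> s < real j / real n + 1 / real n")
      case True
      then show ?thesis
        using d[of j] \<open>j \<in> _\<close> hat_mono[OF assms(2), of n j] by (auto intro!: mult_left_mono)
    next
      case False
      then show ?thesis using hat_eq[of s t n j] assms by auto
    qed
  qed
  also have "\<dots> = e * (t - s)"
    unfolding S[symmetric] by (simp add: sum_distrib_left mult.commute)
  finally show ?thesis .
qed

lemma polygon_node: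
  assumes e: "\<And>k. e (Suc k) = e k + (1 / real n) *\<^sub>R d k" and "n > 0" "k \<le> n"
  shows "polygon n (e 0) d (real k / real n) = e k"
proof -
  have "e 0 + (\<Sum>j<k. (1 / real n) *\<^sub>R d j) = e k" for k
    by (induction k) (auto simp: e add.assoc)
  moreover have "(\<Sum>j<n. hat n j (real k / real n) *\<^sub>R d j) = (\<Sum>j<k. (1 / real n) *\<^sub>R d j)"
    using assms by (intro sum.mono_neutral_cong_right) (auto simp: hat_node)
  ultimately show ?thesis by (simp add: polygon_def)
qed

text \<open>The slopes are values of \<open>V\<close> on a compact set, so the polygons are
  uniformly Lipschitz and a subsequence converges uniformly. Near \<open>t\<close> all slopes of a
  fine polygon are close to \<open>V t (z t)\<close>, so \<open>z\<close> can be differentiated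
  directly, without passing through an integral equation.\<close>

lemma euler_polygon_limit:
  fixes V :: "real \<Rightarrow> 'a::euclidean_space \<Rightarrow> 'a" and e :: "nat \<Rightarrow> nat \<Rightarrow> 'a"
  assumes V: "continuous_on UNIV (\<lambda>(t, z). V t z)"
    and e: "\<And>n k. n > 0 \<Longrightarrow> e n (Suc k) = e n k + (1 / real n) *\<^sub>R V (real k / real n) (e n k)"
    and R: "\<And>n k. n > 0 \<Longrightarrow> k \<le> n \<Longrightarrow> norm (e n k) \<le> R"
    and per: "\<And>n. n > 0 \<Longrightarrow> e n n = e n 0"
  obtains z where "\<And>t. t \<in> {0..1} \<Longrightarrow> (z has_vector_derivative V t (z t)) (at t within {0..1})"
    "z 1 = z 0"
proof -
  define d where "d n k = V (real k / real n) (e n k)" for n k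
  \<comment> \<open>The shift to \<open>Suc n\<close> keeps the mesh positive for every index of the
    sequence.\<close>
  define P where "P n = polygon (Suc n) (e (Suc n) 0) (d (Suc n))" for n
  have "compact ((\<lambda>(t, z). V t z) ` ({0..1} \<times> cball 0 R))"
    by (intro compact_continuous_image continuous_on_subset[OF V] compact_Times) auto
  then obtain D where D': "D > 0" "\<forall>w \<in> (\<lambda>(t, z). V t z) ` ({0..1} \<times> cball 0 R). norm w \<le> D"
    using compact_imp_bounded bounded_pos by metis
  have D: "D > 0" "\<And>t z. t \<in> {0..1} \<Longrightarrow> norm z \<le> R \<Longrightarrow> norm (V t z) \<le> D"
    using D'(2)[THEN bspec, OF imageI[of "(_, _)"]] D'(1) by simp_all
  have dD: "norm (d n k) \<le> D" if "n > 0" "k < n" for n k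
    using that R[of n k] by (auto simp: d_def intro!: D(2))
  have node: "P n (real k / real (Suc n)) = e (Suc n) k" if "k \<le> Suc n" for n k
    unfolding P_def using that e by (intro polygon_node) (auto simp: d_def)
  have Lip': "norm (P n t - P n s) \<le> D * (t - s)" if "0 \<le> s" "s \<le> t" "t \<le> 1" for n s t
    using polygon_diff[OF that, of "Suc n" "d (Suc n)" 0 D "e (Suc n) 0"] dD[of "Suc n"]
    by (auto simp: P_def)
  have Lip: "norm (P n t - P n s) \<le> D * \<bar>t - s\<bar>" if "t \<in> {0..1}" "s \<in> {0..1}" for n s t
    using Lip'[of s t n] Lip'[of t s n] that by (cases "s \<le> t") (auto simp: norm_minus_commute)
  have bnd: "norm (P n t) \<le> R + D" if "t \<in> {0..1}" for n t
  proof -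
    have "norm (P n t) \<le> norm (P n t - P n 0) + norm (P n 0)"
      using norm_triangle_ineq[of "P n t - P n 0" "P n 0"] by simp
    moreover have "norm (P n 0) \<le> R" using node[of 0 n] R[of "Suc n" 0] by simp
    moreover have "norm (P n t - P n 0) \<le> D * \<bar>t - 0\<bar>" using that by (intro Lip) auto
    moreover have "D * \<bar>t - 0\<bar> \<le> D * 1" using that D(1) by (intro mult_left_mono) auto
    ultimately show ?thesis by linarith
  qed
  obtain z r where z: "strict_mono (r :: nat \<Rightarrow> nat)"
    "\<And>e. 0 < e \<Longrightarrow> \<exists>N. \<forall>n t. n \<ge> N \<and> t \<in> {0..1} \<longrightarrow> norm (P (r n) t - z t) < e"
  proof (rule Arzela_Ascoli[of "{0..1::real}" P "R + D"])
    fix t \<epsilon> :: real assume "t \<in> {0..1}" "0 < \<epsilon>"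
    show "\<exists>d>0. \<forall>n y. y \<in> {0..1} \<and> norm (t - y) < d \<longrightarrow> norm (P n t - P n y) < \<epsilon>"
    proof (intro exI[of _ "\<epsilon> / D"] conjI allI impI)
      fix n y assume "y \<in> {0..1} \<and> norm (t - y) < \<epsilon> / D"
      moreover from this have "D * \<bar>t - y\<bar> < \<epsilon>" using D(1) by (simp add: pos_less_divide_eq mult.commute)
      ultimately show "norm (P n t - P n y) < \<epsilon>" using Lip[of t y n] \<open>t \<in> _\<close> by linarith
    qed (use D \<open>0 < \<epsilon>\<close> in auto)
  qed (use bnd in auto)
  have lim: "(\<lambda>n. P (r n) t) \<longlonglongrightarrow> z t" if "t \<in> {0..1}" for t
    unfolding LIMSEQ_iff using z(2) that by meson
  have der: "(z has_vector_derivative V t (z t)) (at t within {0..1})" if t: "t \<in> {0..1}" for t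
    unfolding has_vector_derivative_def has_derivative_within_alt
  proof (intro conjI allI impI)
    show "bounded_linear (\<lambda>h. h *\<^sub>R V t (z t))" by (rule bounded_linear_scaleR_left)
    fix \<epsilon> :: real assume "0 < \<epsilon>"
    have "isCont (\<lambda>(t, z). V t z) (t, z t)"
      using V by (simp add: continuous_on_eq_continuous_at)
    then obtain \<eta> where \<eta>': "\<eta> > 0"
      "\<forall>w. dist w (t, z t) < \<eta> \<longrightarrow> dist (case w of (t, z) \<Rightarrow> V t z) (V t (z t)) < \<epsilon>"
      unfolding continuous_at_eps_delta using \<open>0 < \<epsilon>\<close> by auto
    have \<eta>: "\<eta> > 0" "\<And>s y. dist (s, y) (t, z t) < \<eta> \<Longrightarrow> dist (V s y) (V t (z t)) < \<epsilon>"
      using \<eta>'(1) \<eta>'(2)[rule_format, of "(_, _)"] by simp_all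
    \<comment> \<open>A cell meeting the \<delta>-neighbourhood of \<open>t\<close>, with mesh below
      \<delta>, has its left node within 2 \<delta> of \<open>t\<close>. That node and the polygon's
      motion up to it cost at most 2 \<delta> (1 + D) = \<eta> / 2; the other \<eta> / 2 is left for
      the uniform convergence at \<open>t\<close>.\<close>
    define \<delta> where "\<delta> = \<eta> / (4 * (1 + D))"
    have \<delta>: "\<delta> > 0" "2 * ((1 + D) * \<delta>) = \<eta> / 2" using \<eta>(1) D(1) by (simp_all add: \<delta>_def divide_simps)
    obtain N where N: "\<And>n s. n \<ge> N \<Longrightarrow> s \<in> {0..1} \<Longrightarrow> norm (P (r n) s - z s) < \<eta> / 2"
      using z(2)[of "\<eta> / 2"] \<eta>(1) by auto
    obtain N' where N': "1 / real (Suc N') < \<delta>" using \<delta> nat_approx_posE by blast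
    have key: "norm (P (r n) s' - P (r n) s - (s' - s) *\<^sub>R V t (z t)) \<le> \<epsilon> * (s' - s)"
      if n: "n \<ge> max N N'" and s: "0 \<le> s" "s \<le> s'" "s' \<le> 1" "\<bar>s - t\<bar> < \<delta>" "\<bar>s' - t\<bar> < \<delta>" for n s s'
      unfolding P_def
    proof (rule polygon_diff[OF s(1-3)])
      let ?n = "Suc (r n)"
      fix j assume j: "j < ?n" "real j / real ?n < s'" "s < real j / real ?n + 1 / real ?n"
      have "1 / real ?n \<le> 1 / real (Suc N')"
        using n seq_suble[OF z(1), of n] by (intro divide_left_mono) auto
      then have n1: "1 / real ?n < \<delta>" using N' by linarith
      let ?s = "real j / real ?n"
      have st: "\<bar>?s - t\<bar> < 2 * \<delta>" using j n1 s by (simp only: abs_less_iff) linarith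
      have s01: "?s \<in> {0..1}" using j(1) by auto
      have "norm (e ?n j - z t) \<le> norm (P (r n) ?s - P (r n) t) + norm (P (r n) t - z t)"
        using node[of j "r n"] j(1) norm_triangle_ineq[of "P (r n) ?s - P (r n) t" "P (r n) t - z t"]
        by (simp del: of_nat_Suc)
      also have "\<dots> < D * \<bar>?s - t\<bar> + \<eta> / 2"
        using Lip[OF s01 t, of "r n"] N[OF _ t, of n] n by auto
      finally have ez: "norm (e ?n j - z t) < D * \<bar>?s - t\<bar> + \<eta> / 2" .
      have "D * \<bar>?s - t\<bar> \<le> D * (2 * \<delta>)" using st D(1) by (intro mult_left_mono) auto
      then have "norm (?s - t) + norm (e ?n j - z t) < 2 * \<delta> + (D * (2 * \<delta>) + \<eta> / 2)"
        using st ez unfolding real_norm_def by linarith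
      also have "\<dots> = \<eta>" using \<delta>(2) by (simp add: algebra_simps)
      finally have "dist (?s, e ?n j) (t, z t) < \<eta>"
        using norm_Pair_le[of "?s - t" "e ?n j - z t"] by (simp add: dist_norm)
      then show "norm (d ?n j - V t (z t)) \<le> \<epsilon>"
        using \<eta>(2) by (auto simp: d_def dist_norm less_imp_le)
    qed auto
    \<comment> \<open>The bound in \<open>key\<close> is not strict and does not depend on
      \<open>n\<close>, so it survives the limit at the two end points.\<close>
    have key': "norm (z s' - z s - (s' - s) *\<^sub>R V t (z t)) \<le> \<epsilon> * (s' - s)"
      if s: "0 \<le> s" "s \<le> s'" "s' \<le> 1" "\<bar>s - t\<bar> < \<delta>" "\<bar>s' - t\<bar> < \<delta>" for s s'
    proof (rule LIMSEQ_le_const2)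
      show "(\<lambda>n. norm (P (r n) s' - P (r n) s - (s' - s) *\<^sub>R V t (z t))) \<longlonglongrightarrow>
        norm (z s' - z s - (s' - s) *\<^sub>R V t (z t))"
        using s by (intro tendsto_intros lim) auto
    qed (use key s in blast)
    show "\<exists>d>0. \<forall>y\<in>{0..1}. norm (y - t) < d \<longrightarrow>
      norm (z y - z t - (y - t) *\<^sub>R V t (z t)) \<le> \<epsilon> * norm (y - t)"
    proof (intro exI[of _ \<delta>] conjI ballI impI \<delta>(1))
      fix y assume y: "y \<in> {0..1}" "norm (y - t) < \<delta>"
      show "norm (z y - z t - (y - t) *\<^sub>R V t (z t)) \<le> \<epsilon> * norm (y - t)"
      proof (cases "t \<le> y")
        case True
        then show ?thesis using key'[of t y] y t \<delta>(1) by auto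
      next
        case False
        have "z y - z t - (y - t) *\<^sub>R V t (z t) = - (z t - z y - (t - y) *\<^sub>R V t (z t))"
          by (simp add: algebra_simps)
        then have "norm (z y - z t - (y - t) *\<^sub>R V t (z t)) = norm (z t - z y - (t - y) *\<^sub>R V t (z t))"
          by (simp only: norm_minus_cancel)
        then show ?thesis using False key'[of y t] y t \<delta>(1) by auto
      qed
    qed
  qed
  have "P n 1 = P n 0" for n
    using node[of 0 n] node[of "Suc n" n] per[of "Suc n"] by (simp del: of_nat_Suc)
  then have "(\<lambda>n. P (r n) 0) \<longlonglongrightarrow> z 1" using lim[of 1] by simp
  then have "z 1 = z 0" using lim[of 0] LIMSEQ_unique by force
  then show thesis using der that by blast
qed

text \<open>In the coordinates \<open>p = x' + x\<close>, \<open>q = x' - x\<close> the equation \<open>x'' = x + g\<close> decouples into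
  \<open>p' = p + g\<close>, \<open>q' = - q + g\<close> up to the bounded term \<open>g\<close>; solving the linear parts for their
  periodic data turns periodicity into a fixed point problem on a square.\<close>

lemma euler_periodic_bounded:
  fixes g :: "real \<times> real \<times> real \<Rightarrow> real" and B :: real and n :: nat
  assumes g: "continuous_on UNIV g" and B: "\<And>z. \<bar>g z\<bar> \<le> B" and n: "n > 0"
    and V: "\<And>t p q. V t (p, q) = (p + g (t, (p - q) / 2, (p + q) / 2), - q + g (t, (p - q) / 2, (p + q) / 2))"
  obtains e :: "nat \<Rightarrow> real \<times> real"
  where "\<And>k. e (Suc k) = e k + (1 / real n) *\<^sub>R V (real k / real n) (e k)"
    "\<And>k. k \<le> n \<Longrightarrow> norm (e k) \<le> 2 * B * exp 1 + 2 * B" "e n = e 0"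
proof -
  define h where "h = 1 / real n"
  have h: "0 < h" "h \<le> 1" using n by (auto simp: h_def)
  have B0: "B \<ge> 0" using B[of 0] by linarith
  define E where "E z k = rec_nat z (\<lambda>k w. w + h *\<^sub>R V (real k * h) w) k" for z k
  have E: "E z 0 = z" "E z (Suc k) = E z k + h *\<^sub>R V (real k * h) (E z k)" for z k
    by (auto simp: E_def)
  define \<gamma> where "\<gamma> z k = g (real k * h, (fst (E z k) - snd (E z k)) / 2, (fst (E z k) + snd (E z k)) / 2)" for z k
  have \<gamma>: "\<bar>\<gamma> z k\<bar> \<le> B" for z k by (simp add: \<gamma>_def B)
  have V': "V (real k * h) (E z k) = (fst (E z k) + \<gamma> z k, - snd (E z k) + \<gamma> z k)" for z k
    using V[of "real k * h" "fst (E z k)" "snd (E z k)"] by (simp add: \<gamma>_def)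
  have fE: "fst (E z (Suc k)) = (1 + h) * fst (E z k) + h * \<gamma> z k" for z k
    unfolding E V' by (simp add: algebra_simps)
  have sE: "snd (E z (Suc k)) = (1 - h) * snd (E z k) + h * \<gamma> z k" for z k
    unfolding E V' by (simp add: algebra_simps)
  have cont: "continuous_on UNIV (\<lambda>z. E z k)" for k
  proof (induction k)
    case (Suc k)
    have "continuous_on UNIV (\<lambda>z. \<gamma> z k)" unfolding \<gamma>_def
      by (rule continuous_on_compose2[OF g]) (auto intro!: continuous_intros Suc)
    then show ?case unfolding E V' by (intro continuous_intros Suc)
  qed (simp add: E)
  \<comment> \<open>The subtracted term is the unforced Euler solution. The forcing adds at most
    \<open>h * B\<close> per step, and these contributions, amplified by \<open>1 + h\<close>, form
    a geometric sum; \<open>q\<close> below is the contracting counterpart.\<close>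
  have p: "\<bar>fst (E z k) - (1 + h) ^ k * fst z\<bar> \<le> B * ((1 + h) ^ k - 1)" for z k
  proof (induction k)
    case (Suc k)
    have "fst (E z (Suc k)) - (1 + h) ^ Suc k * fst z
       = (1 + h) * (fst (E z k) - (1 + h) ^ k * fst z) + h * \<gamma> z k"
      by (simp add: fE algebra_simps)
    also have "\<bar>\<dots>\<bar> \<le> (1 + h) * \<bar>fst (E z k) - (1 + h) ^ k * fst z\<bar> + h * \<bar>\<gamma> z k\<bar>"
      using h abs_triangle_ineq[of "(1 + h) * (fst (E z k) - (1 + h) ^ k * fst z)" "h * \<gamma> z k"]
      by (simp add: abs_mult)
    also have "\<dots> \<le> (1 + h) * (B * ((1 + h) ^ k - 1)) + h * B"
      using h Suc \<gamma>[of z k] by (intro add_mono mult_left_mono) auto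
    finally show ?case by (simp add: algebra_simps)
  qed (simp add: E)
  have q: "\<bar>snd (E z k) - (1 - h) ^ k * snd z\<bar> \<le> B * (1 - (1 - h) ^ k)" for z k
  proof (induction k)
    case (Suc k)
    have "snd (E z (Suc k)) - (1 - h) ^ Suc k * snd z
       = (1 - h) * (snd (E z k) - (1 - h) ^ k * snd z) + h * \<gamma> z k"
      by (simp add: sE algebra_simps)
    also have "\<bar>\<dots>\<bar> \<le> (1 - h) * \<bar>snd (E z k) - (1 - h) ^ k * snd z\<bar> + h * \<bar>\<gamma> z k\<bar>"
      using h abs_triangle_ineq[of "(1 - h) * (snd (E z k) - (1 - h) ^ k * snd z)" "h * \<gamma> z k"]
      by (simp add: abs_mult)
    also have "\<dots> \<le> (1 - h) * (B * (1 - (1 - h) ^ k)) + h * B"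
      using h Suc \<gamma>[of z k] by (intro add_mono mult_left_mono) auto
    finally show ?case by (simp add: algebra_simps)
  qed (simp add: E)
  have a: "(1 + h) ^ n - 1 > 0" using h n by simp
  have b: "1 - (1 - h) ^ n > 0" using h n by (simp add: power_less_one_iff)
  \<comment> \<open>Solving \<open>fst (E z n) = fst z\<close> and
    \<open>snd (E z n) = snd z\<close> for the linear parts shows that the fixed points of \<Phi>
    are exactly the periodic initial values. By \<open>p\<close> and \<open>q\<close> the numerators
    are at most \<open>B\<close> times the denominators, so \<Phi> maps into the square of
    half-width \<open>B\<close>.\<close>
  define \<Phi> where "\<Phi> z = ((((1 + h) ^ n * fst z) - fst (E z n)) / ((1 + h) ^ n - 1),
    (snd (E z n) - (1 - h) ^ n * snd z) / (1 - (1 - h) ^ n))" for z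
  obtain z where z: "z \<in> {-B..B} \<times> {-B..B}" "\<Phi> z = z"
  proof (rule brouwer[of "{-B..B} \<times> {-B..B}" \<Phi>])
    show "compact ({-B..B} \<times> {-B..B})" by (intro compact_Times) auto
    show "convex ({-B..B} \<times> {-B..B})" by (intro convex_Times) auto
    show "{-B..B} \<times> {-B..B} \<noteq> {}" using B0 by auto
    show "continuous_on ({-B..B} \<times> {-B..B}) \<Phi>"
      unfolding \<Phi>_def using a b
      by (intro continuous_intros continuous_on_subset[OF cont]) auto
    have "\<bar>fst (\<Phi> z)\<bar> \<le> B" "\<bar>snd (\<Phi> z)\<bar> \<le> B" for z
      using p[of z n] q[of z n] a b by (auto simp: \<Phi>_def abs_minus_commute pos_divide_le_eq)
    then show "\<Phi> \<in> {-B..B} \<times> {-B..B} \<rightarrow> {-B..B} \<times> {-B..B}"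
      by (auto simp: mem_Times_iff abs_le_iff minus_le_iff)
  qed
  have "fst (\<Phi> z) = fst z" "snd (\<Phi> z) = snd z" using z by auto
  then have "fst (E z n) = fst z" "snd (E z n) = snd z"
    using a b by (simp_all add: \<Phi>_def divide_eq_eq algebra_simps)
  then have per: "E z n = E z 0" by (simp add: prod_eq_iff E)
  \<comment> \<open>The bound must not depend on \<open>n\<close>, since it serves all grids in the
    limit; it rests on \<open>(1 + h) ^ n\<close> being at most \<open>exp 1\<close>.\<close>
  have "norm (E z k) \<le> 2 * B * exp 1 + 2 * B" if "k \<le> n" for k
  proof -
    have "(1 + h) ^ k \<le> (1 + h) ^ n" using h that by (intro power_increasing) auto
    also have "\<dots> \<le> exp h ^ n" using h by (intro power_mono) auto
    also have "\<dots> = exp 1" using n by (simp add: exp_of_nat_mult[symmetric] h_def)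
    finally have 1: "(1 + h) ^ k \<le> exp 1" .
    have f: "\<bar>fst z\<bar> \<le> B" "\<bar>snd z\<bar> \<le> B" using z(1) by (auto simp: mem_Times_iff)
    have "\<bar>fst (E z k)\<bar> \<le> \<bar>fst (E z k) - (1 + h) ^ k * fst z\<bar> + (1 + h) ^ k * \<bar>fst z\<bar>"
      using abs_triangle_ineq[of "fst (E z k) - (1 + h) ^ k * fst z" "(1 + h) ^ k * fst z"] h
      by (simp add: abs_mult)
    also have "\<dots> \<le> B * ((1 + h) ^ k - 1) + (1 + h) ^ k * B"
      using p[of z k] f h by (intro add_mono mult_left_mono) auto
    also have "\<dots> \<le> 2 * B * (1 + h) ^ k" using B0 by (simp add: algebra_simps)
    also have "\<dots> \<le> 2 * B * exp 1" using B0 1 by (intro mult_left_mono) auto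
    finally have F: "\<bar>fst (E z k)\<bar> \<le> 2 * B * exp 1" .
    have h1: "0 \<le> (1 - h) ^ k" "(1 - h) ^ k \<le> 1" using h by (auto simp: power_le_one)
    have "\<bar>snd (E z k)\<bar> \<le> \<bar>snd (E z k) - (1 - h) ^ k * snd z\<bar> + (1 - h) ^ k * \<bar>snd z\<bar>"
      using abs_triangle_ineq[of "snd (E z k) - (1 - h) ^ k * snd z" "(1 - h) ^ k * snd z"] h
      by (simp add: abs_mult)
    also have "\<dots> \<le> B * (1 - (1 - h) ^ k) + (1 - h) ^ k * B"
      using q[of z k] f h1 by (intro add_mono mult_left_mono) auto
    also have "\<dots> \<le> 2 * B" using B0 by (simp add: algebra_simps)
    finally show ?thesis using F norm_Pair_le[of "fst (E z k)" "snd (E z k)"] by simp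
  qed
  then show thesis using that[of "E z"] E per by (simp add: h_def)
qed

text \<open>The periodic Euler orbits are bounded uniformly in \<open>n\<close>, so they have a
  limit in the coordinates \<open>p\<close>, \<open>q\<close>; then \<open>x = (p - q) / 2\<close>
  and \<open>y = (p + q) / 2\<close> undo the decoupling.\<close>

lemma bounded_periodic_solution:
  fixes g :: "real \<times> real \<times> real \<Rightarrow> real"
  assumes g: "continuous_on UNIV g" and B: "\<And>z. \<bar>g z\<bar> \<le> B"
  obtains x y where
    "\<And>t. t \<in> {0..1} \<Longrightarrow> (x has_real_derivative y t) (at t within {0..1})"
    "\<And>t. t \<in> {0..1} \<Longrightarrow> (y has_real_derivative x t + g (t, x t, y t)) (at t within {0..1})"
    "x 1 = x 0" "y 1 = y 0"
proof -
  define V where "V t z = (fst z + g (t, (fst z - snd z) / 2, (fst z + snd z) / 2),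
    - snd z + g (t, (fst z - snd z) / 2, (fst z + snd z) / 2))" for t z
  have "\<exists>e :: nat \<Rightarrow> real \<times> real. n > 0 \<longrightarrow>
    (\<forall>k. e (Suc k) = e k + (1 / real n) *\<^sub>R V (real k / real n) (e k)) \<and>
    (\<forall>k \<le> n. norm (e k) \<le> 2 * B * exp 1 + 2 * B) \<and> e n = e 0" for n
  proof (cases "n > 0")
    case True
    obtain e :: "nat \<Rightarrow> real \<times> real" where
      "\<And>k. e (Suc k) = e k + (1 / real n) *\<^sub>R V (real k / real n) (e k)"
      "\<And>k. k \<le> n \<Longrightarrow> norm (e k) \<le> 2 * B * exp 1 + 2 * B" "e n = e 0"
    proof (rule euler_periodic_bounded[OF g B True, of V])
      show "V t (p, q) = (p + g (t, (p - q) / 2, (p + q) / 2), - q + g (t, (p - q) / 2, (p + q) / 2))" for t p q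
        by (simp add: V_def)
    qed blast
    then show ?thesis by blast
  qed simp
  then obtain e :: "nat \<Rightarrow> nat \<Rightarrow> real \<times> real" where e: "\<And>n. n > 0 \<Longrightarrow>
    (\<forall>k. e n (Suc k) = e n k + (1 / real n) *\<^sub>R V (real k / real n) (e n k)) \<and>
    (\<forall>k \<le> n. norm (e n k) \<le> 2 * B * exp 1 + 2 * B) \<and> e n n = e n 0"
    by metis
  have "continuous_on UNIV (\<lambda>(t, z). V t z)"
    unfolding V_def case_prod_beta
    by (intro continuous_intros continuous_on_compose2[OF g]) auto
  then obtain z where z: "\<And>t. t \<in> {0..1} \<Longrightarrow> (z has_vector_derivative V t (z t)) (at t within {0..1})"
    "z 1 = z 0"
    using euler_polygon_limit[of V e "2 * B * exp 1 + 2 * B"] e by metis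
  have p: "((\<lambda>t. fst (z t)) has_real_derivative fst (V t (z t))) (at t within {0..1})"
   and q: "((\<lambda>t. snd (z t)) has_real_derivative snd (V t (z t))) (at t within {0..1})"
    if "t \<in> {0..1}" for t
    using bounded_linear.has_vector_derivative[OF bounded_linear_fst z(1)[OF that]]
      bounded_linear.has_vector_derivative[OF bounded_linear_snd z(1)[OF that]]
    by (simp_all add: has_real_derivative_iff_has_vector_derivative)
  show thesis
  proof (rule that[of "\<lambda>t. (fst (z t) - snd (z t)) / 2" "\<lambda>t. (fst (z t) + snd (z t)) / 2"])
    fix t :: real assume t: "t \<in> {0..1}"
    show "((\<lambda>t. (fst (z t) - snd (z t)) / 2) has_real_derivative (fst (z t) + snd (z t)) / 2)
      (at t within {0..1})"
      using t by (auto intro!: derivative_eq_intros p q simp: V_def)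
    show "((\<lambda>t. (fst (z t) + snd (z t)) / 2) has_real_derivative (fst (z t) - snd (z t)) / 2 +
      g (t, (fst (z t) - snd (z t)) / 2, (fst (z t) + snd (z t)) / 2)) (at t within {0..1})"
      using t by (auto intro!: derivative_eq_intros p q simp: V_def field_simps)
  qed (simp_all add: z(2))
qed

section \<open>A priori estimates\<close>

lemma first_hit:
  fixes f :: "real \<Rightarrow> real"
  assumes f: "continuous_on {a..b} f" and "f a < y" "t \<in> {a..b}" "y \<le> f t"
  obtains s where "a < s" "s \<le> b" "f s = y" "\<And>r. a \<le> r \<Longrightarrow> r < s \<Longrightarrow> f r < y"
proof -
  let ?S = "{r \<in> {a..b}. f r \<in> {y..}}"
  have "closed ({a..b} \<inter> f -` {y..})"
    by (rule continuous_closed_preimage[OF f]) auto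
  then have "compact ({a..b} \<inter> ({a..b} \<inter> f -` {y..}))" by (intro compact_Int_closed) auto
  also have "{a..b} \<inter> ({a..b} \<inter> f -` {y..}) = ?S" by auto
  finally have "compact ?S" .
  moreover have "?S \<noteq> {}" using assms by auto
  ultimately obtain s where s: "s \<in> ?S" "\<And>r. r \<in> ?S \<Longrightarrow> s \<le> r"
    using compact_attains_inf[of ?S] by auto
  have lt: "f r < y" if "a \<le> r" "r < s" for r
    using s(2)[of r] that s(1) by force
  have "a < s" using s(1) assms(2) by (cases "a = s") auto
  moreover have "f s = y"
  proof (rule ccontr)
    assume "f s \<noteq> y"
    then have "y < f s" using s by auto
    then obtain r where "a \<le> r" "r \<le> s" "f r = y"
      using IVT'[of f a y s] assms(2) s(1) continuous_on_subset[OF f, of "{a..s}"] by auto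
    then show False using lt[of r] \<open>f s \<noteq> y\<close> by (cases "r = s") auto
  qed
  ultimately show thesis using that[of s] lt s(1) by auto
qed

lemma nondecreasing_within:
  fixes f :: "real \<Rightarrow> real"
  assumes "a \<le> b" "{a..b} \<subseteq> S"
    and f: "\<And>t. t \<in> {a..b} \<Longrightarrow> (f has_real_derivative f' t) (at t within S)"
    and "\<And>t. t \<in> {a..b} \<Longrightarrow> 0 \<le> f' t"
  shows "f a \<le> f b"
proof (rule DERIV_nonneg_imp_increasing_open[OF \<open>a \<le> b\<close>])
  have f': "(f has_real_derivative f' t) (at t within {a..b})" if "t \<in> {a..b}" for t
    using f[OF that] assms(2) by (rule DERIV_subset)
  then show "continuous_on {a..b} f" by (rule DERIV_continuous_on)
  fix t assume "a < t" "t < b"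
  then show "\<exists>y. DERIV f t :> y \<and> 0 \<le> y"
    using f'[of t] assms(4)[of t] by (auto simp: at_within_Icc_at)
qed

text \<open>A minimum before 1 has nonnegative slope, one after 0 has nonpositive slope. If the
  minimum lies at an end point, both end points are minima, and \<open>v 0 \<le> v 1\<close>
  squeezes both slopes to zero.\<close>

lemma periodic_min_deriv_zero:
  fixes u v :: "real \<Rightarrow> real"
  assumes u: "\<And>t. t \<in> {0..1} \<Longrightarrow> (u has_real_derivative v t) (at t within {0..1})"
    and per: "u 1 = u 0" "v 0 \<le> v 1"
    and t: "t \<in> {0..1}" and min: "\<And>s. s \<in> {0..1} \<Longrightarrow> u t \<le> u s"
  shows "v t = 0"
proof -
  have right: "0 \<le> v s" if "0 \<le> s" "s < 1" "u s = u t" for s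
  proof (rule ccontr)
    assume "\<not> 0 \<le> v s"
    then have "s \<in> {0..1}" "v s < 0" using that by auto
    then obtain d where d: "d > 0" "\<And>h. h > 0 \<Longrightarrow> s + h \<in> {0..1} \<Longrightarrow> h < d \<Longrightarrow> u s > u (s + h)"
      using has_real_derivative_neg_dec_right[OF u] by blast
    define h where "h = min (d / 2) (1 - s)"
    have h: "h > 0" "h < d" "s + h \<in> {0..1}" using that d(1) by (auto simp: h_def min_def)
    show False using d(2)[OF h(1,3,2)] min[OF h(3)] that(3) by simp
  qed
  have left: "v s \<le> 0" if "0 < s" "s \<le> 1" "u s = u t" for s
  proof (rule ccontr)
    assume "\<not> v s \<le> 0"
    then have "s \<in> {0..1}" "0 < v s" using that by auto
    then obtain d where d: "d > 0" "\<And>h. h > 0 \<Longrightarrow> s - h \<in> {0..1} \<Longrightarrow> h < d \<Longrightarrow> u s > u (s - h)"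
      using has_real_derivative_pos_inc_left[OF u] by blast
    define h where "h = min (d / 2) s"
    have h: "h > 0" "h < d" "s - h \<in> {0..1}" using that d(1) by (auto simp: h_def min_def)
    show False using d(2)[OF h(1,3,2)] min[OF h(3)] that(3) by simp
  qed
  consider "t = 0" | "t = 1" | "0 < t" "t < 1" using t by fastforce
  then show ?thesis
    using right[of t] left[of t] right[of 0] left[of 1] per by cases auto
qed

text \<open>At a negative minimum \<open>v\<close> vanishes, so \<open>w < 0\<close> there makes
  \<open>v\<close> negative just to the right and \<open>u\<close> drops below its minimum. A sign
  of \<open>w\<close> is therefore needed only at critical points.\<close>

lemma periodic_min_principle:
  fixes u v w :: "real \<Rightarrow> real"
  assumes u: "\<And>t. t \<in> {0..1} \<Longrightarrow> (u has_real_derivative v t) (at t within {0..1})"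
    and v: "\<And>t. t \<in> {0..1} \<Longrightarrow> (v has_real_derivative w t) (at t within {0..1})"
    and per: "u 1 = u 0" "v 0 \<le> v 1"
    and neg: "\<And>t. t \<in> {0..1} \<Longrightarrow> u t < 0 \<Longrightarrow> v t = 0 \<Longrightarrow> w t < 0"
    and t: "t \<in> {0..1}"
  shows "0 \<le> u t"
proof (rule ccontr)
  assume "\<not> 0 \<le> u t"
  have "continuous_on {0..1} u" using u by (rule DERIV_continuous_on)
  then obtain s' where s': "s' \<in> {0..1}" "\<And>r. r \<in> {0..1} \<Longrightarrow> u s' \<le> u r"
    using continuous_attains_inf[of "{0..1::real}" u] by auto
  \<comment> \<open>A minimum at 1 is moved to 0, so that there is room to the right of it.\<close>
  define s where "s = (if s' = 1 then 0 else s')"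
  have s: "0 \<le> s" "s < 1" "\<And>r. r \<in> {0..1} \<Longrightarrow> u s \<le> u r"
    using s' per(1) by (auto simp: s_def)
  have v0: "v s = 0" using periodic_min_deriv_zero[OF u per _ s(3)] s by auto
  have "u s < 0" using s(3)[OF t] \<open>\<not> 0 \<le> u t\<close> by simp
  then have "s \<in> {0..1}" "w s < 0" using neg[of s] v0 s by auto
  then obtain d where d: "d > 0" "\<And>h. h > 0 \<Longrightarrow> s + h \<in> {0..1} \<Longrightarrow> h < d \<Longrightarrow> v s > v (s + h)"
    using has_real_derivative_neg_dec_right[OF v] by blast
  define b where "b = s + min (d / 2) (1 - s)"
  have b: "s < b" "b \<le> 1" "b - s < d" using s d(1) by (auto simp: b_def)
  have "u b < u s"
  proof (rule DERIV_neg_imp_decreasing_open[OF b(1)])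
    show "continuous_on {s..b} u"
      using \<open>continuous_on {0..1} u\<close> by (rule continuous_on_subset) (use s b in auto)
    fix r assume r: "s < r" "r < b"
    then have "v r < 0" using d(2)[of "r - s"] v0 s b by auto
    moreover have "DERIV u r :> v r" using u[of r] r s b by (auto simp: at_within_Icc_at)
    ultimately show "\<exists>y. DERIV u r :> y \<and> y < 0" by blast
  qed
  then show False using s(3)[of b] b s(1) by auto
qed

text \<open>The bound on \<open>k u\<close> lets the term \<open>c ln u\<close> absorb the quadratic term in the bound for \<open>w\<close>.\<close>

lemma log_energy_mono:
  fixes u v w k :: "real \<Rightarrow> real"
  assumes ab: "0 \<le> a" "a \<le> b" "b \<le> 1"
    and u: "\<And>t. t \<in> {0..1} \<Longrightarrow> (u has_real_derivative v t) (at t within {0..1})"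
    and v: "\<And>t. t \<in> {0..1} \<Longrightarrow> (v has_real_derivative w t) (at t within {0..1})"
    and upos: "\<And>t. t \<in> {a..b} \<Longrightarrow> 0 < u t" and vneg: "\<And>t. t \<in> {a..b} \<Longrightarrow> v t < 0"
    and k: "\<And>t. t \<in> {a..b} \<Longrightarrow> k t * u t \<le> c"
    and w: "\<And>t. t \<in> {a..b} \<Longrightarrow> w t \<le> k t * (v t)\<^sup>2 - L * v t"
  shows "ln (- v a) - c * ln (u a) + L * a \<le> ln (- v b) - c * ln (u b) + L * b"
proof (rule nondecreasing_within[where S = "{0..1}" and f = "\<lambda>t. ln (- v t) - c * ln (u t) + L * t"
      and f' = "\<lambda>t. w t / v t - c * (v t / u t) + L"])
  fix t assume t: "t \<in> {a..b}"
  then have t01: "t \<in> {0..1}" using ab by auto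
  have neg: "v t < 0" and pos: "0 < u t" using vneg upos t by auto
  show "((\<lambda>t. ln (- v t) - c * ln (u t) + L * t) has_real_derivative w t / v t - c * (v t / u t) + L)
    (at t within {0..1})"
    using neg pos by (auto intro!: derivative_eq_intros u v t01)
  \<comment> \<open>Division by the negative \<open>v\<close> reverses the growth bound. The
    \<open>- L\<close> is compensated by the term \<open>L * t\<close>, and \<open>k t * v t\<close>
    by the derivative of \<open>- c * ln (u t)\<close>.\<close>
  have "k t * v t - L \<le> w t / v t"
    unfolding neg_le_divide_eq[OF neg] using w[OF t] by (simp add: power2_eq_square left_diff_distrib)
  moreover have "k t \<le> c / u t" using k[OF t] pos by (simp add: pos_le_divide_eq)
  then have "k t * v t \<ge> c / u t * v t" using neg by (intro mult_right_mono_neg) auto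
  ultimately show "0 \<le> w t / v t - c * (v t / u t) + L" by simp
qed (use ab in auto)

text \<open>The shift by \<open>\<epsilon>\<close> makes the differential inequality strict where \<open>v = \<kappa> (u + \<epsilon>)\<close>, even if
  \<open>u\<close> vanishes there.\<close>

lemma linear_growth_barrier:
  fixes u v w :: "real \<Rightarrow> real" and l \<mu> \<epsilon> :: real
  defines "\<kappa> \<equiv> l + 1"
  assumes ab: "0 \<le> a" "a \<le> b" "b \<le> 1" and "0 < l" "0 < \<epsilon>"
    and u: "\<And>t. t \<in> {0..1} \<Longrightarrow> (u has_real_derivative v t) (at t within {0..1})"
    and v: "\<And>t. t \<in> {0..1} \<Longrightarrow> (v has_real_derivative w t) (at t within {0..1})"
    and u0: "\<And>t. t \<in> {0..1} \<Longrightarrow> 0 \<le> u t"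
    and w: "\<And>t. t \<in> {0..1} \<Longrightarrow> u t \<le> \<mu> \<Longrightarrow> 0 \<le> v t \<Longrightarrow> v t \<le> \<mu> \<Longrightarrow> w t \<le> l * (u t + v t)"
    and small: "(u a + \<epsilon>) * exp (\<kappa> * (b - a)) * \<kappa> \<le> \<mu>"
    and start: "v a < \<kappa> * (u a + \<epsilon>)"
  shows "v b < \<kappa> * (u b + \<epsilon>)" "u b + \<epsilon> \<le> (u a + \<epsilon>) * exp (\<kappa> * (b - a))"
proof -
  have \<kappa>: "\<kappa> > 1" using \<open>0 < l\<close> by (simp add: \<kappa>_def)
  \<comment> \<open>Gronwall: while \<open>v \<le> \<kappa> (u + \<epsilon>)\<close>, the function
    \<open>(u + \<epsilon>) exp (- \<kappa> t)\<close> is nonincreasing.\<close>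
  have growth: "u s + \<epsilon> \<le> (u a + \<epsilon>) * exp (\<kappa> * (s - a))"
    if s: "a \<le> s" "s \<le> b" and le: "\<And>t. t \<in> {a..s} \<Longrightarrow> v t \<le> \<kappa> * (u t + \<epsilon>)" for s
  proof -
    have "- ((u a + \<epsilon>) * exp (- \<kappa> * a)) \<le> - ((u s + \<epsilon>) * exp (- \<kappa> * s))"
    proof (rule nondecreasing_within[where S = "{0..1}"
          and f = "\<lambda>t. - ((u t + \<epsilon>) * exp (- \<kappa> * t))" and f' = "\<lambda>t. (\<kappa> * (u t + \<epsilon>) - v t) * exp (- \<kappa> * t)"])
      fix t assume t: "t \<in> {a..s}"
      then have t01: "t \<in> {0..1}" using s ab by auto
      show "((\<lambda>t. - ((u t + \<epsilon>) * exp (- \<kappa> * t))) has_real_derivative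
        (\<kappa> * (u t + \<epsilon>) - v t) * exp (- \<kappa> * t)) (at t within {0..1})"
        by (rule derivative_eq_intros u t01 refl | simp add: algebra_simps)+
      show "0 \<le> (\<kappa> * (u t + \<epsilon>) - v t) * exp (- \<kappa> * t)" using le[OF t] by simp
    qed (use s ab in auto)
    then have "(u s + \<epsilon>) * exp (- \<kappa> * s) * exp (\<kappa> * s) \<le> (u a + \<epsilon>) * exp (- \<kappa> * a) * exp (\<kappa> * s)"
      by (intro mult_right_mono) auto
    then show ?thesis by (simp add: mult.assoc exp_add[symmetric] algebra_simps)
  qed
  define D where "D t = v t - \<kappa> * (u t + \<epsilon>)" for t
  have dD: "(D has_real_derivative w t - \<kappa> * v t) (at t within {0..1})" if "t \<in> {0..1}" for t
    unfolding D_def using that by (auto intro!: derivative_eq_intros u v)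
  \<comment> \<open>At the first zero \<open>s\<close> of \<open>D\<close>, \<open>growth\<close>
    and \<open>small\<close> give \<open>v s \<le> \<mu>\<close>, so the bound on \<open>w\<close>
    applies. Since \<kappa> = l + 1 and \<open>v s = \<kappa> (u s + \<epsilon>)\<close>, it yields
    \<open>w s - \<kappa> v s < - (u s + \<epsilon>) < 0\<close>. So \<open>D\<close> decreases at
    \<open>s\<close> and cannot have reached 0 from below.\<close>
  have Dneg: "D t < 0" if t: "t \<in> {a..b}" for t
  proof (rule ccontr)
    assume "\<not> D t < 0"
    have "continuous_on {0..1} D" using dD by (rule DERIV_continuous_on)
    then have "continuous_on {a..b} D" by (rule continuous_on_subset) (use ab in auto)
    then obtain s where s: "a < s" "s \<le> b" "D s = 0" "\<And>r. a \<le> r \<Longrightarrow> r < s \<Longrightarrow> D r < 0"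
      using first_hit[of a b D 0 t] start t \<open>\<not> D t < 0\<close> by (auto simp: D_def)
    have s01: "s \<in> {0..1}" using s ab by auto
    have "D r \<le> 0" if "r \<in> {a..s}" for r
      using s(3) s(4)[of r] that by (cases "r = s") auto
    then have "u s + \<epsilon> \<le> (u a + \<epsilon>) * exp (\<kappa> * (s - a))"
      using s by (intro growth) (auto simp: D_def)
    also have "\<dots> \<le> (u a + \<epsilon>) * exp (\<kappa> * (b - a))"
      using s \<kappa> ab u0[of a] \<open>0 < \<epsilon>\<close> by (intro mult_left_mono) auto
    finally have "(u s + \<epsilon>) * \<kappa> \<le> \<mu>"
      using small \<kappa> by (smt (verit) mult_right_mono)
    moreover have vs: "v s = \<kappa> * (u s + \<epsilon>)" using s(3) by (simp add: D_def)
    ultimately have "v s \<le> \<mu>" by (simp add: mult.commute)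
    moreover have upos: "0 < u s + \<epsilon>" using u0[OF s01] \<open>0 < \<epsilon>\<close> by simp
    then have "1 * (u s + \<epsilon>) \<le> \<kappa> * (u s + \<epsilon>)" using \<kappa> by (intro mult_right_mono) auto
    then have "u s + \<epsilon> \<le> v s" using vs by simp
    then have "u s \<le> v s" "0 \<le> v s" using upos \<open>0 < \<epsilon>\<close> by auto
    ultimately have "w s \<le> l * (u s + v s)" using w[OF s01] by linarith
    also have "\<dots> < l * (u s + \<epsilon> + v s)" using \<open>0 < l\<close> \<open>0 < \<epsilon>\<close> by simp
    also have "\<dots> - \<kappa> * v s = - (u s + \<epsilon>)" unfolding vs \<kappa>_def by (simp add: algebra_simps)
    then have "l * (u s + \<epsilon> + v s) \<le> \<kappa> * v s" using upos by linarith
    finally have "w s - \<kappa> * v s < 0" by simp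
    then obtain d where d: "d > 0" "\<And>h. h > 0 \<Longrightarrow> s - h \<in> {0..1} \<Longrightarrow> h < d \<Longrightarrow> D s < D (s - h)"
      using has_real_derivative_neg_dec_left[OF dD[OF s01]] by auto
    define h where "h = min (d / 2) (s - a)"
    have "D s < D (s - h)" using s ab d(1) by (intro d(2)) (auto simp: h_def)
    moreover have "D (s - h) < 0" using s d(1) by (intro s(4)) (auto simp: h_def)
    ultimately show False using s(3) by simp
  qed
  then show "v b < \<kappa> * (u b + \<epsilon>)" using ab by (auto simp: D_def)
  show "u b + \<epsilon> \<le> (u a + \<epsilon>) * exp (\<kappa> * (b - a))"
    using Dneg ab by (intro growth) (auto simp: D_def less_imp_le)
qed

text \<open>\<open>R\<close> is the factor by which \<open>u\<close> must shrink before the slope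
  recovers to -1: \<open>2 exp (2 (l + 1))\<close> rules out a return to \<open>u t0\<close>, and
  the factor \<open>M (l + 1) / \<mu>\<close> keeps the subsequent growth inside the zone of
  \<open>w_pos\<close>. The bound depends on the constants alone, so a truncation level can be fixed
  before the solution is known.\<close>

lemma slope_lower_bound:
  fixes u v w k :: "real \<Rightarrow> real" and c L l \<mu> M :: real
  defines "R \<equiv> 2 * exp (2 * (l + 1)) * (1 + M * (l + 1) / \<mu>)"
  assumes pos: "0 < c" "0 \<le> L" "0 < l" "0 < \<mu>" "0 \<le> M"
    and u: "\<And>t. t \<in> {0..1} \<Longrightarrow> (u has_real_derivative v t) (at t within {0..1})"
    and v: "\<And>t. t \<in> {0..1} \<Longrightarrow> (v has_real_derivative w t) (at t within {0..1})"
    and per: "u 1 = u 0" "v 0 \<le> v 1"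
    and u0: "\<And>t. t \<in> {0..1} \<Longrightarrow> 0 \<le> u t" and uM: "\<And>t. t \<in> {0..1} \<Longrightarrow> u t \<le> M"
    and k: "\<And>t. t \<in> {0..1} \<Longrightarrow> k t * u t \<le> c"
    and w_neg: "\<And>t. t \<in> {0..1} \<Longrightarrow> v t \<le> -1 \<Longrightarrow> w t \<le> k t * (v t)\<^sup>2 - L * v t"
    and w_pos: "\<And>t. t \<in> {0..1} \<Longrightarrow> u t \<le> \<mu> \<Longrightarrow> 0 \<le> v t \<Longrightarrow> v t \<le> \<mu> \<Longrightarrow> w t \<le> l * (u t + v t)"
    and t0: "t0 \<in> {0..1}"
  shows "- exp (2 * L + c * ln R) \<le> v t0"
proof (rule ccontr)
  assume "\<not> - exp (2 * L + c * ln R) \<le> v t0"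
  then have big: "exp (2 * L + c * ln R) < - v t0" by simp
  define \<kappa> where "\<kappa> = l + 1"
  define E where "E t = ln (- v t) - c * ln (u t) + L * t" for t
  have \<kappa>: "\<kappa> > 1" using pos by (simp add: \<kappa>_def)
  have R1: "2 * exp (2 * \<kappa>) \<le> R" "2 * exp (2 * \<kappa>) * (M * \<kappa> / \<mu>) \<le> R"
    unfolding R_def \<kappa>_def[symmetric] using pos \<kappa> by (auto intro!: mult_left_mono simp del: times_divide_eq_right)
  have "exp (2 * \<kappa>) \<ge> 1" using \<kappa> by simp
  then have R: "R > 1" using R1(1) by linarith
  have "1 \<le> exp (2 * L + c * ln R)" using pos R by simp
  then have vt0: "v t0 < -1" using big by linarith
  then have big': "2 * L + c * ln R < ln (- v t0)"
    using big by (subst exp_less_cancel_iff[symmetric]) simp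
  \<comment> \<open>A zero of the nonnegative \<open>u\<close> is a minimum, where the slope
    vanishes.\<close>
  have upos: "0 < u t" if "t \<in> {0..1}" "v t < 0" for t
  proof (rule ccontr)
    assume "\<not> 0 < u t"
    then have "u t \<le> 0" by simp
    then have "u t \<le> u s" if "s \<in> {0..1}" for s using u0[OF that] by linarith
    then have "v t = 0" using periodic_min_deriv_zero[OF u per that(1)] by blast
    then show False using that by simp
  qed
  have ut0: "0 < u t0" using upos t0 vt0 by simp
  have energy: "E a \<le> E b" if "0 \<le> a" "a \<le> b" "b \<le> 1" "\<And>t. t \<in> {a..b} \<Longrightarrow> v t \<le> -1" for a b
    unfolding E_def
  proof (rule log_energy_mono[OF that(1-3) u v])
    fix t assume t: "t \<in> {a..b}"
    then have t': "t \<in> {0..1}" "v t \<le> -1" using that by auto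
    show "v t < 0" using t' by simp
    show "0 < u t" using upos t' by simp
    show "k t * u t \<le> c" by (rule k[OF t'(1)])
    show "w t \<le> k t * (v t)\<^sup>2 - L * v t" by (rule w_neg[OF t'])
  qed auto
  have cv: "continuous_on {a..b} v" if "0 \<le> a" "b \<le> 1" for a b
  proof (rule continuous_on_subset)
    show "continuous_on {0..1} v" using v by (rule DERIV_continuous_on)
  qed (use that in auto)
  \<comment> \<open>At \<open>T\<close> the term \<open>ln (- v T)\<close> is zero, so the excess of
    \<open>ln (- v t0)\<close> must show up in \<open>c (ln (u t0) - ln (u T))\<close>. Of the loss
    \<open>2 * L\<close>, one \<open>L\<close> covers the difference of the terms
    \<open>L * t\<close> and the other is reserved for crossing from 1 to 0.\<close>
  have shrink: "R * u T < u t0" if "T \<in> {0..1}" "v T = -1" "E t0 - L \<le> E T" for T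
  proof -
    have uT: "0 < u T" using upos that by simp
    have "L * T \<le> L" "0 \<le> L * t0" using that(1) t0 pos by (auto simp: mult_left_le)
    then have "ln (- v t0) - 2 * L \<le> c * (ln (u t0) - ln (u T))"
      using that(2,3) by (simp add: E_def algebra_simps)
    then have "c * ln R < c * (ln (u t0) - ln (u T))" using big' by linarith
    then have "ln R + ln (u T) < ln (u t0)" using pos(1) by (simp add: mult_less_cancel_left)
    then have "ln (R * u T) < ln (u t0)" using R uT by (simp add: ln_mult)
    then show ?thesis using R uT ut0 by simp
  qed
  \<comment> \<open>The barrier will be used with shift \<epsilon> = \<open>u T\<close>, which is
    positive and makes \<open>u T + \<epsilon>\<close> equal to \<open>2 * u T\<close>; the exponent
    2 \<kappa> generously covers the time from \<open>T\<close> to \<open>t0\<close>, through the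
    end of the period if necessary.\<close>
  have contra: False
    if T: "T \<in> {0..1}" "v T = -1" "E t0 - L \<le> E T" and grow: "u t0 + u T \<le> 2 * u T * exp (2 * \<kappa>)" for T
  proof -
    have "2 * exp (2 * \<kappa>) * u T \<le> R * u T" using R1(1) u0[OF T(1)] by (intro mult_right_mono)
    moreover have "2 * u T * exp (2 * \<kappa>) = 2 * exp (2 * \<kappa>) * u T" by simp
    ultimately show False using shrink[OF T] grow u0[OF T(1)] by linarith
  qed
  have small: "2 * u T * exp (2 * \<kappa>) * \<kappa> \<le> \<mu>" if T: "T \<in> {0..1}" "v T = -1" "E t0 - L \<le> E T" for T
  proof -
    have "2 * exp (2 * \<kappa>) * (M * \<kappa> / \<mu>) * u T \<le> R * u T" using R1(2) u0[OF T(1)] by (intro mult_right_mono)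
    also have "\<dots> \<le> M" using shrink[OF T] uM[OF t0] by simp
    finally have "2 * exp (2 * \<kappa>) * (M * \<kappa> / \<mu>) * u T * \<mu> \<le> M * \<mu>"
      using pos by (intro mult_right_mono) auto
    moreover have "2 * exp (2 * \<kappa>) * (M * \<kappa> / \<mu>) * u T * \<mu> = M * (2 * u T * exp (2 * \<kappa>) * \<kappa>)"
      using pos by simp
    ultimately have *: "M * (2 * u T * exp (2 * \<kappa>) * \<kappa>) \<le> M * \<mu>" by simp
    have "M > 0" using uM[OF t0] ut0 by simp
    then show ?thesis using * by simp
  qed
  have barrier: "v b < \<kappa> * (u b + \<epsilon>)" "u b + \<epsilon> \<le> (u a + \<epsilon>) * exp (\<kappa> * (b - a))"
    if "0 \<le> a" "a \<le> b" "b \<le> 1" "0 < \<epsilon>" "(u a + \<epsilon>) * exp (\<kappa> * (b - a)) * \<kappa> \<le> \<mu>"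
      "v a < \<kappa> * (u a + \<epsilon>)" for a b \<epsilon>
    using linear_growth_barrier[OF that(1-3) pos(3) that(4) u v u0 w_pos that(5,6)[unfolded \<kappa>_def]]
    unfolding \<kappa>_def by auto
  have exp_le: "2 * u T * exp (\<kappa> * s) \<le> 2 * u T * exp (2 * \<kappa>)" if "T \<in> {0..1}" "s \<le> 2" for T s
    using that u0[of T] \<kappa> by (intro mult_left_mono) auto
  have exp_le': "2 * u T * exp (\<kappa> * s) * \<kappa> \<le> \<mu>"
    if "T \<in> {0..1}" "v T = -1" "E t0 - L \<le> E T" "s \<le> 2" for T s
    using mult_right_mono[OF exp_le[OF that(1,4)], of \<kappa>] small[OF that(1-3)] \<kappa> by linarith
  \<comment> \<open>\<open>T\<close> is the first time after \<open>t0\<close>, in cyclic order, at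
    which \<open>v\<close> returns to -1. Either it occurs before time 1, or after passing from 1 to
    0, or \<open>v\<close> stays below -1 on the whole period, which contradicts
    \<open>u 1 = u 0\<close>.\<close>
  show False
  proof (cases "\<exists>t\<in>{t0..1}. -1 \<le> v t")
    case True
    then obtain t where t: "t \<in> {t0..1}" "-1 \<le> v t" by blast
    have "continuous_on {t0..1} v" using t0 by (intro cv) auto
    then obtain T where T: "t0 < T" "T \<le> 1" "v T = -1" "\<And>r. t0 \<le> r \<Longrightarrow> r < T \<Longrightarrow> v r < -1"
      by (rule first_hit[OF _ vt0 t]) blast
    have T01: "T \<in> {0..1}" using T t0 by auto
    have "v t \<le> -1" if "t \<in> {t0..T}" for t
      using T(3) T(4)[of t] that by (cases "t = T") auto
    then have "E t0 \<le> E T" using T t0 by (intro energy) auto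
    then have T': "T \<in> {0..1}" "v T = -1" "E t0 - L \<le> E T" using T01 T(3) pos by auto
    have uT: "0 < u T" using upos T' by simp
    have "v T < \<kappa> * (u T + u T)" using T(3) uT \<kappa> mult_pos_pos[of \<kappa> "u T + u T"] by linarith
    moreover have "(u T + u T) * exp (\<kappa> * (1 - T)) * \<kappa> \<le> \<mu>"
      using exp_le'[OF T', of "1 - T"] T01 by simp
    ultimately have 1: "v 1 < \<kappa> * (u 1 + u T)" "u 1 + u T \<le> 2 * u T * exp (\<kappa> * (1 - T))"
      using barrier[of T 1 "u T"] T01 uT by simp_all
    \<comment> \<open>The barrier is carried across the period: \<open>u 0 = u 1\<close> and
      \<open>v 0 \<le> v 1\<close> make its value at 1 an admissible start at 0, with the same
      shift, and the two exponentials multiply.\<close>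
    have "(u 0 + u T) * exp (\<kappa> * t0) \<le> 2 * u T * exp (\<kappa> * (1 - T)) * exp (\<kappa> * t0)"
      using 1(2) per(1) by (intro mult_right_mono) auto
    also have "\<dots> = 2 * u T * exp (\<kappa> * (1 - T + t0))"
      by (simp add: mult.assoc exp_add[symmetric] distrib_left)
    finally have 2: "(u 0 + u T) * exp (\<kappa> * t0) \<le> 2 * u T * exp (\<kappa> * (1 - T + t0))" .
    have "1 - T + t0 \<le> 2" using T01 t0 by auto
    note 3 = exp_le'[OF T' this] exp_le[OF T01 this]
    have "(u 0 + u T) * exp (\<kappa> * t0) * \<kappa> \<le> \<mu>"
      using mult_right_mono[OF 2, of \<kappa>] 3(1) \<kappa> by linarith
    moreover have "v 0 < \<kappa> * (u 0 + u T)" using 1(1) per by simp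
    ultimately have "u t0 + u T \<le> (u 0 + u T) * exp (\<kappa> * t0)"
      using barrier(2)[of 0 t0 "u T"] t0 uT by simp
    then show False using contra[OF T'] 2 3(2) by linarith
  next
    case False
    then have after: "\<And>t. t \<in> {t0..1} \<Longrightarrow> v t < -1" using not_le by blast
    then have "E t0 \<le> E 1" using t0 by (intro energy) (auto intro: less_imp_le)
    moreover have "v 1 < -1" using after t0 by auto
    moreover from this have "ln (- v 1) \<le> ln (- v 0)" using per(2) by simp
    \<comment> \<open>Crossing from 1 to 0 can only increase \<open>ln (- v)\<close>, leaves
      \<open>u\<close> unchanged and removes \<open>L * 1\<close>; this is the loss allowed in
      \<open>shrink\<close>.\<close>
    ultimately have E0: "E t0 - L \<le> E 0" using per(1) by (simp add: E_def)
    have v0: "v 0 < -1" using \<open>v 1 < -1\<close> per(2) by simp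
    show False
    proof (cases "\<exists>t\<in>{0..t0}. -1 \<le> v t")
      case True
      then obtain t where t: "t \<in> {0..t0}" "-1 \<le> v t" by blast
      have "continuous_on {0..t0} v" using t0 by (intro cv) auto
      then obtain T where T: "0 < T" "T \<le> t0" "v T = -1" "\<And>r. 0 \<le> r \<Longrightarrow> r < T \<Longrightarrow> v r < -1"
        by (rule first_hit[OF _ v0 t]) blast
      have T01: "T \<in> {0..1}" using T t0 by auto
      have "v t \<le> -1" if "t \<in> {0..T}" for t
        using T(3) T(4)[of t] that by (cases "t = T") auto
      then have "E 0 \<le> E T" using T t0 by (intro energy) auto
      then have T': "T \<in> {0..1}" "v T = -1" "E t0 - L \<le> E T" using T01 T(3) E0 by auto
      have uT: "0 < u T" using upos T' by simp
      have "v T < \<kappa> * (u T + u T)" using T(3) uT \<kappa> mult_pos_pos[of \<kappa> "u T + u T"] by linarith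
      moreover have le2: "t0 - T \<le> 2" using T01 t0 by auto
      moreover have "(u T + u T) * exp (\<kappa> * (t0 - T)) * \<kappa> \<le> \<mu>"
        using exp_le'[OF T' le2] by simp
      ultimately have "u t0 + u T \<le> 2 * u T * exp (\<kappa> * (t0 - T))"
        using barrier(2)[of T t0 "u T"] T(1,2) t0 uT by simp
      then show False using contra[OF T'] exp_le[OF T01 le2] by linarith
    next
      case False
      have all: "v t < -1" if "t \<in> {0..1}" for t
      proof (cases "t \<le> t0")
        case True
        then have "t \<in> {0..t0}" using that by simp
        then show ?thesis using False not_le by blast
      next
        case False
        then show ?thesis using that by (intro after) auto
      qed
      have "u 1 < u 0"
      proof (rule DERIV_neg_imp_decreasing_open[where f = u and a = 0 and b = 1])
        show "continuous_on {0..1} u" using u by (rule DERIV_continuous_on)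
        fix r :: real assume "0 < r" "r < 1"
        then show "\<exists>y. DERIV u r :> y \<and> y < 0"
          using u[of r] all[of r] by (intro exI[of _ "v r"]) (auto simp: at_within_Icc_at)
      qed simp
      then show False using per by simp
    qed
  qed
qed

section \<open>Existence between lower and upper solutions\<close>

lemma deriv01_eqI:
  assumes "(u has_real_derivative d) (at t within {0..1})" "t \<in> {0..1}"
  shows "deriv01 u t = d"
  using assms vector_derivative_within_closed_interval[of 0 1 t u d]
  by (simp add: deriv01_def has_real_derivative_iff_has_vector_derivative)

lemma C1_01D:
  assumes "C1_01 u"
  shows "\<And>t. t \<in> {0..1} \<Longrightarrow> (u has_real_derivative deriv01 u t) (at t within {0..1})"
    "continuous_on {0..1} u" "continuous_on {0..1} (deriv01 u)"
proof -
  show *: "(u has_real_derivative deriv01 u t) (at t within {0..1})" if "t \<in> {0..1}" for t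
    using assms that
    by (simp add: C1_01_def differentiable_on_def deriv01_def vector_derivative_works
        has_real_derivative_iff_has_vector_derivative)
  show "continuous_on {0..1} u" using * by (rule DERIV_continuous_on)
  show "continuous_on {0..1} (deriv01 u)" using assms by (simp add: C1_01_def)
qed

lemma C1_01I:
  assumes u: "\<And>t. t \<in> {0..1} \<Longrightarrow> (u has_real_derivative v t) (at t within {0..1})"
    and v: "continuous_on {0..1} v"
  shows "C1_01 u"
proof -
  have "continuous_on {0..1} (deriv01 u)"
    using v by (rule continuous_on_eq) (auto simp: deriv01_eqI[OF u])
  then show ?thesis
    using u unfolding C1_01_def differentiable_on_def differentiable_def has_field_derivative_def by blast
qed

lemma periodic_solutionI:
  fixes f :: "real \<times> real \<times> real \<Rightarrow> real"
  assumes f: "continuous_on ({0..1} \<times> UNIV) f"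
    and x: "\<And>t. t \<in> {0..1} \<Longrightarrow> (x has_real_derivative y t) (at t within {0..1})"
    and y: "\<And>t. t \<in> {0..1} \<Longrightarrow> (y has_real_derivative - f (t, x t, y t)) (at t within {0..1})"
    and per: "x 1 = x 0" "y 1 = y 0"
  shows "periodic_solution f x"
proof -
  have cx: "continuous_on {0..1} x" using x by (rule DERIV_continuous_on)
  have cy: "continuous_on {0..1} y" using y by (rule DERIV_continuous_on)
  have dx: "deriv01 x t = y t" if "t \<in> {0..1}" for t using x[OF that] that by (rule deriv01_eqI)
  have y': "(deriv01 x has_real_derivative - f (t, x t, y t)) (at t within {0..1})"
    if "t \<in> {0..1}" for t
    using y[OF that] dx that unfolding has_field_derivative_def by (auto intro: has_derivative_transform)
  have "continuous_on {0..1} (\<lambda>t. - f (t, x t, y t))"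
    by (intro continuous_on_minus continuous_on_compose2[OF f] continuous_on_Pair continuous_on_id cx cy) auto
  then have "C1_01 (deriv01 x)" using y' by (rule C1_01I[rotated])
  moreover have "C1_01 x" using x cy by (rule C1_01I)
  ultimately show ?thesis
    using per dx by (auto simp: periodic_solution_def C2_01_def deriv01_eqI[OF y'])
qed

lemma C2_01_bounded:
  assumes "C2_01 u"
  obtains b where "\<And>t. t \<in> {0..1} \<Longrightarrow> \<bar>u t\<bar> \<le> b \<and> \<bar>deriv01 u t\<bar> \<le> b \<and> \<bar>deriv01 (deriv01 u) t\<bar> \<le> b"
proof -
  have bdd: "\<exists>b. \<forall>t\<in>{0..1}. \<bar>h t\<bar> \<le> b" if "continuous_on {0..1} h" for h :: "real \<Rightarrow> real"
  proof -
    have "bounded (h ` {0..1})"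
      using that by (intro compact_imp_bounded compact_continuous_image) auto
    then show ?thesis by (auto simp: bounded_iff)
  qed
  have C: "C1_01 u" "C1_01 (deriv01 u)" using assms by (auto simp: C2_01_def)
  obtain b1 where b1: "\<forall>t\<in>{0..1}. \<bar>u t\<bar> \<le> b1" using bdd C1_01D(2)[OF C(1)] by blast
  obtain b2 where b2: "\<forall>t\<in>{0..1}. \<bar>deriv01 u t\<bar> \<le> b2" using bdd C1_01D(2)[OF C(2)] by blast
  obtain b3 where b3: "\<forall>t\<in>{0..1}. \<bar>deriv01 (deriv01 u) t\<bar> \<le> b3" using bdd C1_01D(3)[OF C(2)] by blast
  show thesis
    by (rule that[of "max b1 (max b2 b3)"]) (use b1 b2 b3 in \<open>auto simp: le_max_iff_disj\<close>)
qed

section \<open>Truncation, comparison with the lower and upper solutions, and removal of the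
  truncation\<close>

theorem theorem3p4:
  fixes f :: "real \<times> real \<times> real \<Rightarrow> real"
    and \<alpha> \<beta> c_fun :: "real \<Rightarrow> real"
    and \<mu> l L K c :: real
  assumes f_cont: "continuous_on ({0..1} \<times> UNIV) f"
    and lower: "lower_solution f \<alpha>"
    and upper: "upper_solution f \<beta>"
    and ordered: "\<forall>t\<in>{0..1}. \<alpha> t \<le> \<beta> t"
    and lower_bc: "deriv01 \<alpha> 0 - deriv01 \<alpha> 1 \<ge> 0"
    and upper_bc: "deriv01 \<beta> 1 - deriv01 \<beta> 0 \<ge> 0"
    and "\<mu> > 0" and "l > 0"
    and lipschitz: "\<forall>t x1 y1 x2 y2.
          ((t, x1, y1) \<in> G \<alpha> \<mu> \<and> (t, x2, y2) \<in> G \<alpha> \<mu>) \<or>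
          ((t, x1, y1) \<in> G \<beta> \<mu> \<and> (t, x2, y2) \<in> G \<beta> \<mu>) \<longrightarrow>
          \<bar>f (t, x1, y1) - f (t, x2, y2)\<bar> \<le> l * \<bar>x1 - x2\<bar> + l * \<bar>y1 - y2\<bar>"
    and "L > 0" and "K > 0" and "c < 1"
    and c_fun: "\<forall>t\<in>{0..1}. c_fun t \<ge> 0 \<and> c_fun t * (\<beta> t - \<alpha> t) \<le> c"
    and growth_lower: "\<forall>t\<in>{0..1}. \<forall>x z. \<alpha> t \<le> x \<and> x \<le> \<beta> t \<and> z \<ge> 0 \<longrightarrow>
          f (t, x, deriv01 \<alpha> t - z) - f (t, x, deriv01 \<alpha> t) \<ge> - c_fun t * z\<^sup>2 - L * z - K"
    and growth_upper: "\<forall>t\<in>{0..1}. \<forall>x z. \<alpha> t \<le> x \<and> x \<le> \<beta> t \<and> z \<ge> 0 \<longrightarrow>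
          f (t, x, deriv01 \<beta> t) - f (t, x, deriv01 \<beta> t + z) \<ge> - c_fun t * z\<^sup>2 - L * z - K"
  shows "\<exists>x. periodic_solution f x \<and> (\<forall>t\<in>{0..1}. \<alpha> t \<le> x t \<and> x t \<le> \<beta> t)"
proof -
  define A1 A2 B1 B2 where "A1 = deriv01 \<alpha>" and "A2 = deriv01 A1" and "B1 = deriv01 \<beta>" and "B2 = deriv01 B1"
  have C1: "C1_01 \<alpha>" "C1_01 A1" "C1_01 \<beta>" "C1_01 B1"
    using lower upper by (auto simp: lower_solution_def upper_solution_def C2_01_def A1_def B1_def)
  note d\<alpha> = C1_01D(1)[OF C1(1), folded A1_def] and dA1 = C1_01D(1)[OF C1(2), folded A2_def]
  note d\<beta> = C1_01D(1)[OF C1(3), folded B1_def] and dB1 = C1_01D(1)[OF C1(4), folded B2_def]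
  have low: "\<And>t. t \<in> {0..1} \<Longrightarrow> - A2 t \<le> f (t, \<alpha> t, A1 t)" "\<alpha> 1 = \<alpha> 0" "A1 1 \<le> A1 0"
    using lower lower_bc by (auto simp: lower_solution_def A1_def A2_def)
  have upp: "\<And>t. t \<in> {0..1} \<Longrightarrow> f (t, \<beta> t, B1 t) \<le> - B2 t" "\<beta> 1 = \<beta> 0" "B1 0 \<le> B1 1"
    using upper upper_bc by (auto simp: upper_solution_def B1_def B2_def)
  obtain a where a: "\<And>t. t \<in> {0..1} \<Longrightarrow> \<bar>\<alpha> t\<bar> \<le> a \<and> \<bar>A1 t\<bar> \<le> a \<and> \<bar>A2 t\<bar> \<le> a"
    using lower C2_01_bounded[of \<alpha>] unfolding lower_solution_def A1_def A2_def by blast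
  obtain b where b: "\<And>t. t \<in> {0..1} \<Longrightarrow> \<bar>\<beta> t\<bar> \<le> b \<and> \<bar>B1 t\<bar> \<le> b \<and> \<bar>B2 t\<bar> \<le> b"
    using upper C2_01_bounded[of \<beta>] unfolding upper_solution_def B1_def B2_def by blast
  define A where "A = max a b"
  have A: "\<bar>\<alpha> t\<bar> \<le> A" "\<bar>A1 t\<bar> \<le> A" "\<bar>A2 t\<bar> \<le> A" "\<bar>\<beta> t\<bar> \<le> A" "\<bar>B1 t\<bar> \<le> A" "\<bar>B2 t\<bar> \<le> A"
    if "t \<in> {0..1}" for t
    using a[OF that] b[OF that] unfolding A_def by (simp_all add: le_max_iff_disj)
  have A0: "0 \<le> A" using A(1)[of 0] by simp
  have f_bdd: "\<exists>C. \<forall>t x y. t \<in> {0..1} \<and> \<bar>x\<bar> \<le> a \<and> \<bar>y\<bar> \<le> b \<longrightarrow> \<bar>f (t, x, y)\<bar> \<le> C" for a b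
  proof -
    have "compact (f ` ({0..1} \<times> {-a..a} \<times> {-b..b}))"
      by (intro compact_continuous_image continuous_on_subset[OF f_cont] compact_Times) auto
    then obtain C where "\<forall>z\<in>{0..1} \<times> {-a..a} \<times> {-b..b}. \<bar>f z\<bar> \<le> C"
      by (auto dest!: compact_imp_bounded simp: bounded_iff)
    then show ?thesis by (intro exI[of _ C]) (auto simp: abs_le_iff)
  qed
  obtain C where C: "\<And>t x y. t \<in> {0..1} \<Longrightarrow> \<bar>x\<bar> \<le> A \<Longrightarrow> \<bar>y\<bar> \<le> A \<Longrightarrow> \<bar>f (t, x, y)\<bar> \<le> C"
    using f_bdd[of A A] by blast
  have C0: "0 \<le> C" using C[of 0 0 0] A0 by simp
  \<comment> \<open>\<open>slope_lower_bound\<close> asks for a positive constant; enlarging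
    \<open>c\<close> preserves the bound on \<open>c_fun\<close>.\<close>
  define c' where "c' = max c 1"
  \<comment> \<open>For slopes of absolute value at least 1 the constants \<open>K\<close>,
    \<open>C\<close> (a bound for \<open>f\<close> along the derivative of \<alpha> or \<beta>) and
    \<open>A\<close> (a bound for the second derivatives) are absorbed into the linear term.\<close>
  define L' where "L' = L + K + C + A"
  define N0 where "N0 = exp (2 * L' + c' * ln (2 * exp (2 * (l + 1)) * (1 + (2 * A) * (l + 1) / \<mu>)))"
  \<comment> \<open>\<open>N0 + A\<close> will bound the derivative of the solution;
    \<open>A + \<mu>\<close> ensures that \<open>Y\<close> does not act in the Lipschitz
    neighbourhoods of \<alpha> and \<beta>.\<close>
  define N where "N = N0 + A + \<mu>"
  have cL: "0 < c'" "0 \<le> L'" using \<open>L > 0\<close> \<open>K > 0\<close> A0 C0 by (auto simp: c'_def L'_def)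
  have N0: "0 < N0" by (simp add: N0_def)
  define \<tau> where "\<tau> t = max 0 (min 1 t)" for t :: real
  have \<tau>: "\<tau> t \<in> {0..1}" "t \<in> {0..1} \<Longrightarrow> \<tau> t = t" for t by (auto simp: \<tau>_def)
  define X where "X t x = max (\<alpha> (\<tau> t)) (min (\<beta> (\<tau> t)) x)" for t x
  define Y where "Y y = max (- N) (min N y)" for y
  \<comment> \<open>With this \<open>g\<close>, \<open>x + g\<close> equals
    \<open>(x - X) - f (\<tau> t, X, Y)\<close>. The difference \<open>x - X\<close> vanishes
    between \<alpha> and \<beta> and has a strict sign outside, as the minimum principle requires.
    The retraction \<tau> makes \<open>g\<close> continuous on the whole space.\<close>
  define g where "g = (\<lambda>(t, x, y). - f (\<tau> t, X t x, Y y) - X t x)"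
  have X_bdd: "\<bar>X t x\<bar> \<le> A" for t x
    using A(1,4)[OF \<tau>(1), of t] by (auto simp: X_def)
  have Y_bdd: "\<bar>Y y\<bar> \<le> N" for y using A0 N0 \<open>\<mu> > 0\<close> by (auto simp: Y_def N_def)
  have c\<tau>: "continuous_on UNIV (\<lambda>z :: real \<times> real \<times> real. \<tau> (fst z))"
    unfolding \<tau>_def by (intro continuous_intros)
  have cX: "continuous_on UNIV (\<lambda>z :: real \<times> real \<times> real. X (fst z) (fst (snd z)))"
    unfolding X_def
    by (intro continuous_intros continuous_on_compose2[OF C1_01D(2)[OF C1(1)] c\<tau>]
        continuous_on_compose2[OF C1_01D(2)[OF C1(3)] c\<tau>]) (use \<tau> in auto)
  have cY: "continuous_on UNIV (\<lambda>z :: real \<times> real \<times> real. Y (snd (snd z)))"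
    unfolding Y_def by (intro continuous_intros)
  have "continuous_on UNIV g"
    unfolding g_def case_prod_beta
    by (intro continuous_on_diff continuous_on_minus continuous_on_compose2[OF f_cont]
        continuous_on_Pair c\<tau> cX cY) (use \<tau> in auto)
  moreover obtain C' where C': "\<And>t x y. t \<in> {0..1} \<Longrightarrow> \<bar>x\<bar> \<le> A \<Longrightarrow> \<bar>y\<bar> \<le> N \<Longrightarrow> \<bar>f (t, x, y)\<bar> \<le> C'"
    using f_bdd[of A N] by blast
  have "\<bar>g z\<bar> \<le> C' + A" for z
  proof (cases z)
    case (fields t x y)
    then show ?thesis
      using C'[OF \<tau>(1)[of t] X_bdd[of t x] Y_bdd[of y]] X_bdd[of t x] by (simp add: g_def)
  qed
  ultimately obtain x y where
    x: "\<And>t. t \<in> {0..1} \<Longrightarrow> (x has_real_derivative y t) (at t within {0..1})" and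
    y: "\<And>t. t \<in> {0..1} \<Longrightarrow> (y has_real_derivative x t + g (t, x t, y t)) (at t within {0..1})" and
    per: "x 1 = x 0" "y 1 = y 0"
    using bounded_periodic_solution by blast
  \<comment> \<open>Where \<open>x < \<alpha>\<close> with equal slopes, both clamps return the data
    of \<alpha>, so \<open>w\<close> is \<open>x - \<alpha>\<close> minus the nonnegative defect
    \<open>f (t, \<alpha> t, A1 t) + A2 t\<close>.\<close>
  have above: "\<alpha> t \<le> x t" if "t \<in> {0..1}" for t
  proof -
    have "0 \<le> x t - \<alpha> t"
    proof (rule periodic_min_principle[where u = "\<lambda>t. x t - \<alpha> t" and v = "\<lambda>t. y t - A1 t"
          and w = "\<lambda>t. x t + g (t, x t, y t) - A2 t"])
      fix t :: real assume t: "t \<in> {0..1}" "x t - \<alpha> t < 0" "y t - A1 t = 0"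
      then have "X t (x t) = \<alpha> t" using ordered by (auto simp: X_def \<tau>(2))
      moreover have "Y (y t) = A1 t"
        using A(2)[OF t(1)] t(3) N0 \<open>\<mu> > 0\<close> by (auto simp: Y_def N_def)
      ultimately show "x t + g (t, x t, y t) - A2 t < 0"
        using low(1)[OF t(1)] t by (simp add: g_def \<tau>(2))
    qed (use per low that in \<open>auto intro!: derivative_intros x y d\<alpha> dA1\<close>)
    then show ?thesis by simp
  qed
  have below: "x t \<le> \<beta> t" if "t \<in> {0..1}" for t
  proof -
    have "0 \<le> \<beta> t - x t"
    proof (rule periodic_min_principle[where u = "\<lambda>t. \<beta> t - x t" and v = "\<lambda>t. B1 t - y t"
          and w = "\<lambda>t. B2 t - (x t + g (t, x t, y t))"])
      fix t :: real assume t: "t \<in> {0..1}" "\<beta> t - x t < 0" "B1 t - y t = 0"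
      then have "X t (x t) = \<beta> t" using ordered by (auto simp: X_def \<tau>(2))
      moreover have "Y (y t) = B1 t"
        using A(5)[OF t(1)] t(3) N0 \<open>\<mu> > 0\<close> by (auto simp: Y_def N_def)
      ultimately show "B2 t - (x t + g (t, x t, y t)) < 0"
        using upp(1)[OF t(1)] t by (simp add: g_def \<tau>(2))
    qed (use per upp that in \<open>auto intro!: derivative_intros x y d\<beta> dB1\<close>)
    then show ?thesis by simp
  qed
  have y': "(y has_real_derivative - f (t, x t, Y (y t))) (at t within {0..1})" if "t \<in> {0..1}" for t
    using y[OF that] above[OF that] below[OF that] by (simp add: g_def X_def \<tau>(2)[OF that])
  have k_bound: "c_fun t * s \<le> c'" if "t \<in> {0..1}" "s \<le> \<beta> t - \<alpha> t" for t s
    using c_fun that mult_left_mono[of s "\<beta> t - \<alpha> t" "c_fun t"] by (force simp: c'_def)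
  have quad: "c_fun t * z\<^sup>2 + L * z + K + C + A \<le> c_fun t * s\<^sup>2 - L' * s"
    if "t \<in> {0..1}" "0 \<le> z" "z \<le> - s" "s \<le> - 1" for t z s
  proof -
    have "z\<^sup>2 \<le> s\<^sup>2" using power_mono[of z "- s" 2] that by simp
    then have "c_fun t * z\<^sup>2 \<le> c_fun t * s\<^sup>2" using c_fun that(1) by (intro mult_left_mono) auto
    moreover have "L * z \<le> L * - s" using that \<open>L > 0\<close> by (intro mult_left_mono) auto
    moreover have "(K + C + A) * 1 \<le> (K + C + A) * - s"
      using that \<open>K > 0\<close> C0 A0 by (intro mult_left_mono) auto
    ultimately show ?thesis by (simp add: L'_def algebra_simps)
  qed
  have lower_slope: "- N0 \<le> y t - A1 t" if "t \<in> {0..1}" for t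
    unfolding N0_def
  proof (rule slope_lower_bound[where u = "\<lambda>t. x t - \<alpha> t" and v = "\<lambda>t. y t - A1 t"
        and w = "\<lambda>t. - f (t, x t, Y (y t)) - A2 t" and k = c_fun])
    fix t :: real assume t: "t \<in> {0..1}"
    show "x t - \<alpha> t \<le> 2 * A" using below[OF t] A(1,4)[OF t] by simp
    show "c_fun t * (x t - \<alpha> t) \<le> c'" using below[OF t] t by (intro k_bound) auto
    show "- f (t, x t, Y (y t)) - A2 t \<le> c_fun t * (y t - A1 t)\<^sup>2 - L' * (y t - A1 t)"
      if v: "y t - A1 t \<le> - 1"
    proof -
      \<comment> \<open>The deviation uses the clamped slope. Clamping can only shorten it, and
        \<open>A \<le> N\<close> keeps it nonnegative, so \<open>quad\<close> still bounds it by the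
        true slope.\<close>
      define z where "z = A1 t - Y (y t)"
      have z: "0 \<le> z" "z \<le> - (y t - A1 t)"
        using v A(2)[OF t] N0 \<open>\<mu> > 0\<close> by (auto simp: z_def Y_def N_def)
      have "f (t, x t, A1 t - z) - f (t, x t, A1 t) \<ge> - c_fun t * z\<^sup>2 - L * z - K"
        using growth_lower t above[OF t] below[OF t] z unfolding A1_def by blast
      moreover have "\<bar>f (t, x t, A1 t)\<bar> \<le> C"
        using above[OF t] below[OF t] A[OF t] t by (intro C) auto
      ultimately show ?thesis using quad[OF t z v] A(3)[OF t] by (simp add: z_def)
    qed
    show "- f (t, x t, Y (y t)) - A2 t \<le> l * (x t - \<alpha> t + (y t - A1 t))"
      if v: "x t - \<alpha> t \<le> \<mu>" "0 \<le> y t - A1 t" "y t - A1 t \<le> \<mu>"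
    proof -
      have "Y (y t) = y t" using v A(2)[OF t] N0 by (auto simp: Y_def N_def)
      moreover have "(t, x t, y t) \<in> G \<alpha> \<mu>" "(t, \<alpha> t, A1 t) \<in> G \<alpha> \<mu>"
        using t v above[OF t] \<open>\<mu> > 0\<close> by (auto simp: G_def A1_def)
      then have "\<bar>f (t, x t, y t) - f (t, \<alpha> t, A1 t)\<bar> \<le> l * \<bar>x t - \<alpha> t\<bar> + l * \<bar>y t - A1 t\<bar>"
        using lipschitz by blast
      ultimately show ?thesis using low(1)[OF t] v above[OF t] by (simp add: distrib_left)
    qed
  qed (use cL \<open>l > 0\<close> \<open>\<mu> > 0\<close> A0 per low above that in \<open>auto intro!: derivative_intros x y' d\<alpha> dA1\<close>)
  have dv: "((\<lambda>t. B1 t - y t) has_real_derivative B2 t + f (t, x t, Y (y t))) (at t within {0..1})"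
    if "t \<in> {0..1}" for t
    using DERIV_diff[OF dB1[OF that] y'[OF that]] by simp
  \<comment> \<open>The same estimate for \<open>\<beta> - x\<close>, where \<beta> is the upper
    solution and the growth condition bounds \<open>f\<close> from above.\<close>
  have upper_slope: "- N0 \<le> B1 t - y t" if "t \<in> {0..1}" for t
    unfolding N0_def
  proof (rule slope_lower_bound[where u = "\<lambda>t. \<beta> t - x t" and v = "\<lambda>t. B1 t - y t"
        and w = "\<lambda>t. B2 t + f (t, x t, Y (y t))" and k = c_fun])
    fix t :: real assume t: "t \<in> {0..1}"
    show "\<beta> t - x t \<le> 2 * A" using above[OF t] A(1,4)[OF t] by simp
    show "c_fun t * (\<beta> t - x t) \<le> c'" using above[OF t] t by (intro k_bound) auto
    show "B2 t + f (t, x t, Y (y t)) \<le> c_fun t * (B1 t - y t)\<^sup>2 - L' * (B1 t - y t)"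
      if v: "B1 t - y t \<le> - 1"
    proof -
      define z where "z = Y (y t) - B1 t"
      have z: "0 \<le> z" "z \<le> - (B1 t - y t)"
        using v A(5)[OF t] N0 \<open>\<mu> > 0\<close> by (auto simp: z_def Y_def N_def)
      have "f (t, x t, B1 t) - f (t, x t, B1 t + z) \<ge> - c_fun t * z\<^sup>2 - L * z - K"
        using growth_upper t above[OF t] below[OF t] z unfolding B1_def by blast
      moreover have "\<bar>f (t, x t, B1 t)\<bar> \<le> C"
        using above[OF t] below[OF t] A[OF t] t by (intro C) auto
      ultimately show ?thesis using quad[OF t z v] A(6)[OF t] by (simp add: z_def)
    qed
    show "B2 t + f (t, x t, Y (y t)) \<le> l * (\<beta> t - x t + (B1 t - y t))"
      if v: "\<beta> t - x t \<le> \<mu>" "0 \<le> B1 t - y t" "B1 t - y t \<le> \<mu>"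
    proof -
      have "Y (y t) = y t" using v A(5)[OF t] N0 by (auto simp: Y_def N_def)
      moreover have "(t, x t, y t) \<in> G \<beta> \<mu>" "(t, \<beta> t, B1 t) \<in> G \<beta> \<mu>"
        using t v below[OF t] \<open>\<mu> > 0\<close> by (auto simp: G_def B1_def)
      then have "\<bar>f (t, x t, y t) - f (t, \<beta> t, B1 t)\<bar> \<le> l * \<bar>x t - \<beta> t\<bar> + l * \<bar>y t - B1 t\<bar>"
        using lipschitz by blast
      ultimately show ?thesis using upp(1)[OF t] v below[OF t] by (simp add: distrib_left abs_minus_commute)
    qed
  qed (use cL \<open>l > 0\<close> \<open>\<mu> > 0\<close> A0 per upp below that in \<open>auto intro!: derivative_intros x d\<beta> dv\<close>)
  \<comment> \<open>The two slope bounds place \<open>y\<close> between \<open>A1 - N0\<close> and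
    \<open>B1 + N0\<close>, hence within \<open>N\<close>, so the truncated equation is the original
    one.\<close>
  have "Y (y t) = y t" if "t \<in> {0..1}" for t
    using lower_slope[OF that] upper_slope[OF that] A(2,5)[OF that] \<open>\<mu> > 0\<close>
    by (auto simp: Y_def N_def)
  then have "(y has_real_derivative - f (t, x t, y t)) (at t within {0..1})" if "t \<in> {0..1}" for t
    using y'[OF that] that by simp
  then have "periodic_solution f x" using periodic_solutionI[OF f_cont x _ per] by blast
  then show ?thesis using above below by blast
qed

end
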